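(* Let $(X,\mathcal{A},\mu)$ be a measure space with $\mu(X)>0$ such that $X$ is not an atom. Then the diameter of the comaximal graph is $$diam(\Gamma'_2(\mathcal{M}(X,\mathcal{A})))=\begin{cases}2&\text{if }X\text{ is partitioned into two atoms},\\ 3&\text{otherwise,}\end{cases}$$ where "$X$ is partitioned into two atoms" means $X=A\sqcup B$ for some atoms $A,B\in\mathcal{A}$.
   Context: $\mathcal{M}(X,\mathcal{A})$ is the commutative ring (pointwise operations) of all $\mathcal{A}$-measurable functions $f:X\to\mathbb{R}$; $Z(f)=\{x\in X:f(x)=0\}$. A set $A\in\mathcal{A}$ is an atom if $\mu(A)>0$ and $A$ cannot be written as a disjoint union $A=B\sqcup C$ with $B,C\in\mathcal{A}$, $\mu(B)>0$, $\mu(C)>0$. A function $u\in\mathcal{M}(X,\mathcal{A})$ is a $\mu$-unit if $\mu(Z(u))=0$. Write $\mathscr{D}=\{f\in\mathcal{M}(X,\mathcal{A}):\mu(Z(f))>0\text{ and }\mu(X\setminus Z(f))>0\}$, i.e. the functions that are neither $\mu$-units nor equal to $0$ almost everywhere. The comaximal graph $\Gamma'_2(\mathcal{M}(X,\mathcal{A}))$ is the simple graph with vertex set $\mathscr{D}$ in which distinct $f,g$ are adjacent iff the sum of principal ideals $\langle f\rangle+\langle g\rangle$ equals $\langle u\rangle$ for some $\mu$-unit $u$. $d(f,g)$ is the length of a shortest path joining $f$ and $g$; the diameter is $\max\{d(f,g):f,g\in\mathscr{D}\}$. *)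

theory Defs
  imports
    "HOL-Analysis.Analysis"
    "HOL-Algebra.Ideal"
    "HOL-Library.Extended_Nat"
    "Graph_Theory.Pair_Digraph"
begin

definition atom :: "'a measure \<Rightarrow> 'a set \<Rightarrow> bool" where
  "atom M A \<longleftrightarrow>
     A \<in> sets M \<and> emeasure M A > 0 \<and>
     \<not> (\<exists>B\<in>sets M. \<exists>C\<in>sets M.
          A = B \<union> C \<and> B \<inter> C = {} \<and> emeasure M B > 0 \<and> emeasure M C > 0)"

(* HOL functions are total on the type 'a; restricting the carrier to extensional functions
   makes its elements correspond one-to-one to the measurable functions space M -> R. *)
definition measurable_ring :: "'a measure \<Rightarrow> ('a \<Rightarrow> real) ring" where
  "measurable_ring M =
     \<lparr> carrier = borel_measurable M \<inter> extensional (space M),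
       mult = (\<lambda>f g. \<lambda>x\<in>space M. f x * g x),
       one = (\<lambda>x\<in>space M. 1),
       zero = (\<lambda>x\<in>space M. 0),
       add = (\<lambda>f g. \<lambda>x\<in>space M. f x + g x) \<rparr>"

definition zero_set :: "'a measure \<Rightarrow> ('a \<Rightarrow> real) \<Rightarrow> 'a set" where
  "zero_set M f = {x \<in> space M. f x = 0}"

definition mu_unit :: "'a measure \<Rightarrow> ('a \<Rightarrow> real) \<Rightarrow> bool" where
  "mu_unit M u \<longleftrightarrow> u \<in> carrier (measurable_ring M) \<and> emeasure M (zero_set M u) = 0"

definition comaximal_vertices :: "'a measure \<Rightarrow> ('a \<Rightarrow> real) set" where
  "comaximal_vertices M =
     {f \<in> carrier (measurable_ring M).
        emeasure M (zero_set M f) > 0 \<and> emeasure M (space M - zero_set M f) > 0}"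

(* A simple graph is encoded as a symmetric, loop-free set of ordered pairs. *)
definition comaximal_graph :: "'a measure \<Rightarrow> ('a \<Rightarrow> real) pair_pre_digraph" where
  "comaximal_graph M =
     \<lparr> pverts = comaximal_vertices M,
       parcs = {(f, g). f \<in> comaximal_vertices M \<and> g \<in> comaximal_vertices M \<and> f \<noteq> g \<and>
         (\<exists>u. mu_unit M u \<and>
            PIdl\<^bsub>measurable_ring M\<^esub> f <+>\<^bsub>measurable_ring M\<^esub> PIdl\<^bsub>measurable_ring M\<^esub> g
              = PIdl\<^bsub>measurable_ring M\<^esub> u)} \<rparr>"

(* The infimum over the empty set is infinity: vertices not joined by a path are at
   infinite distance. *)
definition graph_distance :: "'v pair_pre_digraph \<Rightarrow> 'v \<Rightarrow> 'v \<Rightarrow> enat" where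
  "graph_distance G u v =
     (INF p \<in> {p. pre_digraph.apath (with_proj G) u p v}. enat (length p))"

(* A nonempty set of extended naturals with finite supremum attains it, so for a graph with
   vertices a finite value is the maximum of the distances. *)
definition graph_diameter :: "'v pair_pre_digraph \<Rightarrow> enat" where
  "graph_diameter G = (SUP u \<in> pverts G. SUP v \<in> pverts G. graph_distance G u v)"

lemma restrict_borel_measurable:
  "f \<in> borel_measurable M \<Longrightarrow> restrict f (space M) \<in> borel_measurable M"
  by (subst measurable_cong[where g = f]) auto

lemma cring_measurable_ring: "cring (measurable_ring M)"
proof (rule cringI)
  show "abelian_group (measurable_ring M)"
  proof (rule abelian_groupI)
    fix f assume f: "f \<in> carrier (measurable_ring M)"
    show "\<exists>g\<in>carrier (measurable_ring M).
        g \<oplus>\<^bsub>measurable_ring M\<^esub> f = \<zero>\<^bsub>measurable_ring M\<^esub>"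
      by (rule bexI[of _ "\<lambda>x\<in>space M. - f x"]) 
        (use f in \<open>auto simp: measurable_ring_def intro!: restrict_borel_measurable\<close>)
  qed (auto simp: measurable_ring_def fun_eq_iff extensional_def
      intro!: restrict_borel_measurable)
  show "Group.comm_monoid (measurable_ring M)"
    by (rule comm_monoidI) (auto simp: measurable_ring_def fun_eq_iff extensional_def
      intro!: restrict_borel_measurable)
qed (auto simp: measurable_ring_def fun_eq_iff algebra_simps)

lemma pair_bidirected_digraph_comaximal_graph: "pair_bidirected_digraph (comaximal_graph M)"
proof -
  interpret cring "measurable_ring M" by (rule cring_measurable_ring)
  have comm: "PIdl\<^bsub>measurable_ring M\<^esub> f <+>\<^bsub>measurable_ring M\<^esub> PIdl\<^bsub>measurable_ring M\<^esub> g =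
      PIdl\<^bsub>measurable_ring M\<^esub> g <+>\<^bsub>measurable_ring M\<^esub> PIdl\<^bsub>measurable_ring M\<^esub> f"
    if "f \<in> comaximal_vertices M" "g \<in> comaximal_vertices M" for f g
    using that by (intro set_add_comm) (auto simp: comaximal_vertices_def cgenideal_def)
  show ?thesis
    by unfold_locales
      (auto simp: comaximal_graph_def symmetric_def comm intro!: symI)
qed

end

(* Since measurable functions may be divided by one another off the zero set of the denominator,
   a principal ideal <f> consists of the functions vanishing on Z(f), and <f> + <g> of those
   vanishing on the intersection of Z(f) and Z(g). So f and g are adjacent iff this intersection
   is null. Every set of positive measure and of positive co-measure is the zero set of a vertex,
   hence distinct non-adjacent f, g have a common neighbour iff the union of Z(f) and Z(g) is not
   co-null; otherwise the indicators of Z(f) and Z(g) give a path of length 3. The latter case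
   occurs iff X splits into three sets of positive measure. *)
theory Submission
  imports Defs
begin

section \<open>Principal ideals described by zero sets\<close>

lemma zero_set_measurable [measurable]:
  "f \<in> borel_measurable M \<Longrightarrow> zero_set M f \<in> sets M"
  unfolding zero_set_def by measurable

lemma mem_carrier_measurable_ring:
  "f \<in> carrier (measurable_ring M) \<longleftrightarrow> f \<in> borel_measurable M \<and> f \<in> extensional (space M)"
  by (simp add: measurable_ring_def)

lemma PIdl_measurable_ring:
  assumes "f \<in> carrier (measurable_ring M)"
  shows "PIdl\<^bsub>measurable_ring M\<^esub> f =
    {h \<in> carrier (measurable_ring M). zero_set M f \<subseteq> zero_set M h}"
proof (intro equalityI subsetI)
  fix h assume "h \<in> PIdl\<^bsub>measurable_ring M\<^esub> f"
  then show "h \<in> {h \<in> carrier (measurable_ring M). zero_set M f \<subseteq> zero_set M h}"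
    using assms unfolding cgenideal_def
    by (auto simp: measurable_ring_def zero_set_def intro!: restrict_borel_measurable)
next
  fix h assume h: "h \<in> {h \<in> carrier (measurable_ring M). zero_set M f \<subseteq> zero_set M h}"
  \<comment> \<open>Since \<open>x / 0 = 0\<close>, this quotient needs no case split to be
    measurable; on the zero set of \<open>f\<close> both \<open>h\<close> and \<open>k * f\<close>
    vanish.\<close>
  define k where "k = (\<lambda>x\<in>space M. h x / f x)"
  have "k \<in> carrier (measurable_ring M)"
    using h assms unfolding k_def
    by (auto simp: mem_carrier_measurable_ring intro!: restrict_borel_measurable)
  moreover have "h = k \<otimes>\<^bsub>measurable_ring M\<^esub> f"
    using h by (auto simp: measurable_ring_def k_def zero_set_def fun_eq_iff extensional_def)
  ultimately show "h \<in> PIdl\<^bsub>measurable_ring M\<^esub> f"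
    unfolding cgenideal_def by blast
qed

lemma PIdl_add_measurable_ring:
  assumes "f \<in> carrier (measurable_ring M)" "g \<in> carrier (measurable_ring M)"
  shows "PIdl\<^bsub>measurable_ring M\<^esub> f <+>\<^bsub>measurable_ring M\<^esub> PIdl\<^bsub>measurable_ring M\<^esub> g =
    {h \<in> carrier (measurable_ring M). zero_set M f \<inter> zero_set M g \<subseteq> zero_set M h}"
proof (intro equalityI subsetI)
  fix h assume "h \<in> PIdl\<^bsub>measurable_ring M\<^esub> f <+>\<^bsub>measurable_ring M\<^esub> PIdl\<^bsub>measurable_ring M\<^esub> g"
  then obtain a b where "a \<in> carrier (measurable_ring M)" "b \<in> carrier (measurable_ring M)"
    "zero_set M f \<subseteq> zero_set M a" "zero_set M g \<subseteq> zero_set M b"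
    "h = a \<oplus>\<^bsub>measurable_ring M\<^esub> b"
    unfolding PIdl_measurable_ring[OF assms(1)] PIdl_measurable_ring[OF assms(2)] set_add_def'
    by blast
  moreover from this have "zero_set M a \<inter> zero_set M b \<subseteq> zero_set M h"
    by (auto simp: measurable_ring_def zero_set_def)
  ultimately show "h \<in> {h \<in> carrier (measurable_ring M). zero_set M f \<inter> zero_set M g \<subseteq> zero_set M h}"
    by (auto simp: measurable_ring_def intro!: restrict_borel_measurable)
next
  fix h
  assume h: "h \<in> {h \<in> carrier (measurable_ring M). zero_set M f \<inter> zero_set M g \<subseteq> zero_set M h}"
  \<comment> \<open>The weights \<open>f\<^sup>2 / (f\<^sup>2 + g\<^sup>2)\<close> and
    \<open>g\<^sup>2 / (f\<^sup>2 + g\<^sup>2)\<close> add up to 1 off the common zeros, and the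
    first vanishes with \<open>f\<close>, the second with \<open>g\<close>. At common zeros
    \<open>h\<close> vanishes, and so do \<open>a\<close> and \<open>b\<close>.\<close>
  define a where "a = (\<lambda>x\<in>space M. h x * (f x)\<^sup>2 / ((f x)\<^sup>2 + (g x)\<^sup>2))"
  define b where "b = (\<lambda>x\<in>space M. h x * (g x)\<^sup>2 / ((f x)\<^sup>2 + (g x)\<^sup>2))"
  have "a \<in> PIdl\<^bsub>measurable_ring M\<^esub> f" "b \<in> PIdl\<^bsub>measurable_ring M\<^esub> g"
    using h assms unfolding PIdl_measurable_ring[OF assms(1)] PIdl_measurable_ring[OF assms(2)]
    by (auto simp: a_def b_def mem_carrier_measurable_ring zero_set_def
        intro!: restrict_borel_measurable)
  moreover have "h x = a x + b x" if "x \<in> space M" for x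
  proof (cases "f x = 0 \<and> g x = 0")
    case True
    then show ?thesis using that h by (auto simp: a_def b_def zero_set_def)
  next
    case False
    then have "(f x)\<^sup>2 + (g x)\<^sup>2 \<noteq> 0" by (simp add: sum_power2_eq_zero_iff)
    then show ?thesis
      using that by (simp add: a_def b_def flip: add_divide_distrib distrib_left)
  qed
  then have "h = a \<oplus>\<^bsub>measurable_ring M\<^esub> b"
    using h by (auto simp: measurable_ring_def fun_eq_iff extensional_def)
  ultimately show "h \<in> PIdl\<^bsub>measurable_ring M\<^esub> f <+>\<^bsub>measurable_ring M\<^esub> PIdl\<^bsub>measurable_ring M\<^esub> g"
    unfolding set_add_def' by blast
qed

section \<open>Vertices with a prescribed zero set, and adjacency\<close>

text \<open>The factor \<open>c\<close> makes it possible to have different functions with the same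
  zero set; the lower bound for two atoms relies on such a pair.\<close>

lemma restrict_indicator_carrier:
  "A \<in> sets M \<Longrightarrow> (\<lambda>x\<in>space M. c * indicator A x) \<in> carrier (measurable_ring M)"
  by (auto simp: mem_carrier_measurable_ring intro!: restrict_borel_measurable)

lemma zero_set_restrict_indicator:
  "c \<noteq> 0 \<Longrightarrow> zero_set M (\<lambda>x\<in>space M. c * indicator A x) = space M - A"
  by (auto simp: zero_set_def indicator_def)

lemma comaximal_vertices_restrict_indicator:
  assumes "A \<in> sets M" "c \<noteq> 0" "emeasure M A > 0" "emeasure M (space M - A) > 0"
  shows "(\<lambda>x\<in>space M. c * indicator A x) \<in> comaximal_vertices M"
  using assms sets.sets_into_space[OF assms(1)] restrict_indicator_carrier[OF assms(1)]
  by (simp add: comaximal_vertices_def zero_set_restrict_indicator double_diff)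

lemma zero_set_sets: "f \<in> comaximal_vertices M \<Longrightarrow> zero_set M f \<in> sets M"
  by (simp add: comaximal_vertices_def mem_carrier_measurable_ring zero_set_measurable)

lemma pverts_comaximal_graph [simp]: "pverts (comaximal_graph M) = comaximal_vertices M"
  by (simp add: comaximal_graph_def)

text \<open>Generators of the same principal ideal have the same zero set, so the sum ideal is
  generated by a \<open>mu_unit\<close> exactly when the common zero set is null.\<close>

lemma parcs_comaximal_graph:
  "(f, g) \<in> parcs (comaximal_graph M) \<longleftrightarrow>
    f \<in> comaximal_vertices M \<and> g \<in> comaximal_vertices M \<and>
    emeasure M (zero_set M f \<inter> zero_set M g) = 0"
proof (cases "f \<in> comaximal_vertices M \<and> g \<in> comaximal_vertices M")
  case True
  then have fg: "f \<in> carrier (measurable_ring M)" "g \<in> carrier (measurable_ring M)"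
    by (auto simp: comaximal_vertices_def)
  let ?Z = "zero_set M f \<inter> zero_set M g"
  \<comment> \<open>This function vanishes exactly on \<open>?Z\<close> and therefore generates the
    sum of the two ideals.\<close>
  let ?w = "\<lambda>x\<in>space M. 1 * indicator (space M - ?Z) x :: real"
  have Z: "?Z \<in> sets M" using True by (auto intro: zero_set_sets)
  have w: "?w \<in> carrier (measurable_ring M)" "zero_set M ?w = ?Z"
    using restrict_indicator_carrier[of "space M - ?Z" M 1] Z sets.sets_into_space[OF Z]
    by (simp_all only: zero_set_restrict_indicator double_diff) auto
  have sum: "PIdl\<^bsub>measurable_ring M\<^esub> f <+>\<^bsub>measurable_ring M\<^esub> PIdl\<^bsub>measurable_ring M\<^esub> g =
      PIdl\<^bsub>measurable_ring M\<^esub> ?w"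
    using w by (simp only: PIdl_add_measurable_ring[OF fg] PIdl_measurable_ring)
  have "(\<exists>u. mu_unit M u \<and> PIdl\<^bsub>measurable_ring M\<^esub> ?w = PIdl\<^bsub>measurable_ring M\<^esub> u) \<longleftrightarrow>
      emeasure M ?Z = 0"
  proof
    assume "\<exists>u. mu_unit M u \<and> PIdl\<^bsub>measurable_ring M\<^esub> ?w = PIdl\<^bsub>measurable_ring M\<^esub> u"
    then obtain u where u: "u \<in> carrier (measurable_ring M)" "emeasure M (zero_set M u) = 0"
      "PIdl\<^bsub>measurable_ring M\<^esub> ?w = PIdl\<^bsub>measurable_ring M\<^esub> u"
      by (auto simp: mu_unit_def)
    have "?w \<in> PIdl\<^bsub>measurable_ring M\<^esub> u"
      unfolding u(3)[symmetric] using w(1) by (simp only: PIdl_measurable_ring) blast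
    \<comment> \<open>Each generator lies in the ideal of the other, which gives both
      inclusions.\<close>
    then have "zero_set M u = zero_set M ?w"
      using u w(1) by (auto simp only: PIdl_measurable_ring)
    then show "emeasure M ?Z = 0" using u w by simp
  next
    assume "emeasure M ?Z = 0"
    then show "\<exists>u. mu_unit M u \<and> PIdl\<^bsub>measurable_ring M\<^esub> ?w = PIdl\<^bsub>measurable_ring M\<^esub> u"
      using w unfolding mu_unit_def by metis
  qed
  \<comment> \<open>Distinctness comes for free: for \<open>f = g\<close> the intersection is the
    zero set of a vertex, which has positive measure.\<close>
  moreover have "f \<noteq> g" if "emeasure M ?Z = 0"
    using that True by (auto simp: comaximal_vertices_def)
  moreover have "(f, g) \<in> parcs (comaximal_graph M) \<longleftrightarrow>
      f \<noteq> g \<and> (\<exists>u. mu_unit M u \<and> PIdl\<^bsub>measurable_ring M\<^esub> ?w = PIdl\<^bsub>measurable_ring M\<^esub> u)"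
    using True unfolding sum[symmetric] by (auto simp: comaximal_graph_def)
  ultimately show ?thesis
    using True by blast
qed (auto simp: comaximal_graph_def)

section \<open>Bounds on graph distance and diameter\<close>

lemma graph_distance_le_length:
  "pre_digraph.apath (with_proj G) u p v \<Longrightarrow> graph_distance G u v \<le> enat (length p)"
  unfolding graph_distance_def by (rule INF_lower) simp

lemma graph_distance_refl: "u \<in> pverts G \<Longrightarrow> graph_distance G u u = 0"
  using graph_distance_le_length[of G u "[]" u]
  by (simp add: pre_digraph.apath_def pre_digraph.awalk_def pre_digraph.cas.simps
      pre_digraph.awalk_verts.simps flip: zero_enat_def)

lemma graph_distance_le_1:
  assumes "u \<in> pverts G" "u \<noteq> v" "(u, v) \<in> parcs G"
  shows "graph_distance G u v \<le> 1"
  using graph_distance_le_length[of G u "[(u, v)]" v] assms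
  by (simp add: pre_digraph.apath_def pre_digraph.awalk_def pre_digraph.cas.simps
      pre_digraph.awalk_verts.simps one_enat_def)

text \<open>The explicit walk is a path in the sense of \<open>apath\<close> only if its vertices
  are pairwise different, hence the \<open>distinct\<close> assumption.\<close>

lemma graph_distance_le_2:
  assumes "u \<in> pverts G" "distinct [u, w, v]" "(u, w) \<in> parcs G" "(w, v) \<in> parcs G"
  shows "graph_distance G u v \<le> 2"
  using graph_distance_le_length[of G u "[(u, w), (w, v)]" v] assms
  by (simp add: pre_digraph.apath_def pre_digraph.awalk_def pre_digraph.cas.simps
      pre_digraph.awalk_verts.simps numeral_eq_enat eval_nat_numeral)

lemma graph_distance_le_3:
  assumes "u \<in> pverts G" "distinct [u, w, z, v]"
    and "(u, w) \<in> parcs G" "(w, z) \<in> parcs G" "(z, v) \<in> parcs G"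
  shows "graph_distance G u v \<le> 3"
  using graph_distance_le_length[of G u "[(u, w), (w, z), (z, v)]" v] assms
  by (simp add: pre_digraph.apath_def pre_digraph.awalk_def pre_digraph.cas.simps
      pre_digraph.awalk_verts.simps numeral_eq_enat eval_nat_numeral)

text \<open>A shorter path would be \<open>[]\<close> or \<open>[e]\<close>, forcing
  \<open>u = v\<close> or an arc from \<open>u\<close> to \<open>v\<close>. Without any path the
  infimum is infinity, so the bound still holds.\<close>

lemma graph_distance_ge_2:
  assumes "u \<noteq> v" "(u, v) \<notin> parcs G"
  shows "2 \<le> graph_distance G u v"
  unfolding graph_distance_def
proof (rule INF_greatest, clarify)
  fix p assume p: "pre_digraph.apath (with_proj G) u p v"
  have "p \<noteq> []" "p \<noteq> [e]" for e
    using p assms by (cases e; auto simp: pre_digraph.apath_def pre_digraph.awalk_def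
        pre_digraph.cas.simps)+
  then have "2 \<le> length p" by (cases p; cases "tl p") auto
  then show "2 \<le> enat (length p)" by (simp add: numeral_eq_enat)
qed

text \<open>Besides \<open>[]\<close> and \<open>[e]\<close> only the shape \<open>[e, e']\<close>
  remains to be excluded; its middle vertex would contradict the last assumption.\<close>

lemma graph_distance_ge_3:
  assumes "u \<noteq> v" "(u, v) \<notin> parcs G"
    and "\<And>w. (u, w) \<in> parcs G \<Longrightarrow> (w, v) \<notin> parcs G"
  shows "3 \<le> graph_distance G u v"
  unfolding graph_distance_def
proof (rule INF_greatest, clarify)
  fix p assume p: "pre_digraph.apath (with_proj G) u p v"
  have "p \<noteq> []" "p \<noteq> [e]" "p \<noteq> [e, e']" for e e'
    using p assms by (cases e; cases e'; auto simp: pre_digraph.apath_def pre_digraph.awalk_def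
        pre_digraph.cas.simps)+
  then have "3 \<le> length p" by (cases p; cases "tl p"; cases "tl (tl p)") auto
  then show "3 \<le> enat (length p)" by (simp add: numeral_eq_enat)
qed

lemma graph_distance_le_graph_diameter:
  "u \<in> pverts G \<Longrightarrow> v \<in> pverts G \<Longrightarrow> graph_distance G u v \<le> graph_diameter G"
  unfolding graph_diameter_def by (meson SUP_upper2 order_refl)

lemma graph_diameter_leI:
  "(\<And>u v. u \<in> pverts G \<Longrightarrow> v \<in> pverts G \<Longrightarrow> graph_distance G u v \<le> n) \<Longrightarrow>
    graph_diameter G \<le> n"
  unfolding graph_diameter_def by (intro SUP_least)

section \<open>Upper bounds on distances in the comaximal graph\<close>

lemma comaximal_graph_distance_le_2:
  assumes f: "f \<in> comaximal_vertices M" and g: "g \<in> comaximal_vertices M"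
    and "emeasure M (zero_set M f \<inter> zero_set M g) = 0 \<or>
      emeasure M (space M - (zero_set M f \<union> zero_set M g)) > 0"
  shows "graph_distance (comaximal_graph M) f g \<le> 2"
proof (cases "f = g \<or> (f, g) \<in> parcs (comaximal_graph M)")
  case True
  then show ?thesis
    using f graph_distance_refl[of f "comaximal_graph M"]
      graph_distance_le_1[of f "comaximal_graph M" g]
    by (cases "f = g") (auto intro: order_trans[of _ 1] simp: one_enat_def numeral_eq_enat)
next
  case False
  let ?A = "zero_set M f \<union> zero_set M g"
  \<comment> \<open>The common neighbour: it vanishes exactly off both zero sets, so its zero set is
    disjoint from each of them.\<close>
  let ?h = "\<lambda>x\<in>space M. 1 * indicator ?A x :: real"
  have A: "?A \<in> sets M" using f g by (auto intro: zero_set_sets)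
  have co: "emeasure M (space M - ?A) > 0"
    using False assms by (auto simp: parcs_comaximal_graph)
  have "emeasure M (zero_set M f) \<le> emeasure M ?A"
    using A by (intro emeasure_mono) auto
  then have "emeasure M ?A > 0"
    using f by (auto simp: comaximal_vertices_def)
  then have h: "?h \<in> comaximal_vertices M"
    using A co by (intro comaximal_vertices_restrict_indicator) auto
  have "zero_set M f \<inter> zero_set M ?h = {}" "zero_set M ?h \<inter> zero_set M g = {}"
    by (auto simp only: zero_set_restrict_indicator)
  then have arcs: "(f, ?h) \<in> parcs (comaximal_graph M)" "(?h, g) \<in> parcs (comaximal_graph M)"
    using f g h by (simp_all only: parcs_comaximal_graph emeasure_empty)
  \<comment> \<open>If \<open>?h\<close> were equal to \<open>f\<close> or \<open>g\<close>, one of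
    the two arcs would join \<open>f\<close> to \<open>g\<close>, contrary to the case
    assumption.\<close>
  have "?h \<noteq> f" "?h \<noteq> g" using False arcs by metis+
  then show ?thesis
    using False f arcs by (intro graph_distance_le_2[where w = ?h]) auto
qed

lemma comaximal_graph_distance_le_3:
  assumes f: "f \<in> comaximal_vertices M" and g: "g \<in> comaximal_vertices M"
  shows "graph_distance (comaximal_graph M) f g \<le> 3"
proof (cases "f = g \<or> emeasure M (zero_set M f \<inter> zero_set M g) = 0 \<or>
      emeasure M (space M - (zero_set M f \<union> zero_set M g)) > 0")
  case True
  then have "graph_distance (comaximal_graph M) f g \<le> 2"
    using comaximal_graph_distance_le_2[OF f g] graph_distance_refl[of f "comaximal_graph M"] f
    by auto
  then show ?thesis by (rule order_trans) (simp add: numeral_eq_enat)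
next
  case False
  \<comment> \<open>The path is \<open>f\<close>, \<open>?h f\<close>, \<open>?h g\<close>,
    \<open>g\<close>. The zero sets of the inner vertices are the complements of those of
    \<open>f\<close> and \<open>g\<close>; they meet in the complement of the union, which is null
    in this case.\<close>
  let ?h = "\<lambda>f. \<lambda>x\<in>space M. 1 * indicator (zero_set M f) x :: real"
  have Z: "zero_set M (?h k) = space M - zero_set M k" for k :: "'a \<Rightarrow> real"
    by (rule zero_set_restrict_indicator) simp
  have V: "?h k \<in> comaximal_vertices M" if "k \<in> comaximal_vertices M" for k
    using that zero_set_sets[OF that]
    by (intro comaximal_vertices_restrict_indicator) (auto simp: comaximal_vertices_def)
  have "zero_set M f \<inter> zero_set M (?h f) = {}" "zero_set M (?h g) \<inter> zero_set M g = {}"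
    "zero_set M (?h f) \<inter> zero_set M (?h g) = space M - (zero_set M f \<union> zero_set M g)"
    unfolding Z by auto
  then have arcs: "(f, ?h f) \<in> parcs (comaximal_graph M)" "(?h g, g) \<in> parcs (comaximal_graph M)"
    "(?h f, ?h g) \<in> parcs (comaximal_graph M)"
    using V[OF f] V[OF g] f g False
    by (simp_all only: parcs_comaximal_graph emeasure_empty not_gr_zero simp_thms de_Morgan_disj)
  have loop: "(k, k) \<notin> parcs (comaximal_graph M)" for k
    by (auto simp: parcs_comaximal_graph comaximal_vertices_def)
  have nonadj: "(f, g) \<notin> parcs (comaximal_graph M)"
    using False by (simp add: parcs_comaximal_graph)
  \<comment> \<open>Every coincidence would turn one of the three arcs into a loop or into an arc
    from \<open>f\<close> to \<open>g\<close>.\<close>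
  have "?h f \<noteq> g" "?h g \<noteq> f" "?h f \<noteq> f" "?h g \<noteq> g" "?h f \<noteq> ?h g"
    using arcs nonadj loop by metis+
  then show ?thesis
    using False f arcs by (intro graph_distance_le_3[where w = "?h f" and z = "?h g"]) auto
qed

section \<open>Spaces made of two atoms\<close>

text \<open>Otherwise \<open>A \<inter> B\<close> and \<open>A - B\<close> would split the atom. Up
  to null sets an atom thus behaves like a single point.\<close>

lemma atom_null_or_conull:
  assumes "atom M A" "B \<in> sets M"
  shows "emeasure M (A \<inter> B) = 0 \<or> emeasure M (A - B) = 0"
proof (rule ccontr)
  assume "\<not> ?thesis"
  moreover have "A = (A \<inter> B) \<union> (A - B)" "(A \<inter> B) \<inter> (A - B) = {}" by auto
  ultimately show False
    using assms unfolding atom_def by (metis not_gr_zero sets.Diff sets.Int)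
qed

lemma emeasure_Un_eq_0:
  "A \<in> sets M \<Longrightarrow> B \<in> sets M \<Longrightarrow> emeasure M A = 0 \<Longrightarrow> emeasure M B = 0 \<Longrightarrow>
    emeasure M (A \<union> B) = 0"
  using emeasure_subadditive[of A M B] by simp

text \<open>By the dichotomy for atoms, a measurable set is, up to null sets, empty,
  \<open>A\<close>, \<open>B\<close> or the whole space. The two positivity conditions on a vertex
  exclude the first and the last.\<close>

lemma zero_set_two_atoms:
  assumes "atom M A" "atom M B" "space M = A \<union> B" "f \<in> comaximal_vertices M"
  shows "emeasure M (A \<inter> zero_set M f) = 0 \<and> emeasure M (B - zero_set M f) = 0 \<or>
    emeasure M (B \<inter> zero_set M f) = 0 \<and> emeasure M (A - zero_set M f) = 0"
proof -
  have sets: "A \<in> sets M" "B \<in> sets M" "zero_set M f \<in> sets M"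
    using assms zero_set_sets by (auto simp: atom_def)
  have "zero_set M f = (A \<inter> zero_set M f) \<union> (B \<inter> zero_set M f)"
    "space M - zero_set M f = (A - zero_set M f) \<union> (B - zero_set M f)"
    using assms(3) by (auto simp: zero_set_def)
  moreover have "emeasure M (zero_set M f) \<noteq> 0" "emeasure M (space M - zero_set M f) \<noteq> 0"
    using assms(4) by (auto simp: comaximal_vertices_def)
  ultimately have "\<not> (emeasure M (A \<inter> zero_set M f) = 0 \<and> emeasure M (B \<inter> zero_set M f) = 0)"
    "\<not> (emeasure M (A - zero_set M f) = 0 \<and> emeasure M (B - zero_set M f) = 0)"
    using sets emeasure_Un_eq_0 by (metis sets.Int, metis sets.Diff)
  then show ?thesis
    using atom_null_or_conull[OF assms(1) sets(3)] atom_null_or_conull[OF assms(2) sets(3)]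
    by blast
qed

text \<open>Up to null sets every zero set is one of the atoms. Vertices belonging to different
  atoms are adjacent; those belonging to the same atom leave the other one free for a common
  neighbour.\<close>

lemma comaximal_graph_diameter_two_atoms:
  assumes A: "atom M A" and B: "atom M B" and disj: "A \<inter> B = {}" and sp: "space M = A \<union> B"
  shows "graph_diameter (comaximal_graph M) = 2"
proof (rule antisym)
  show "graph_diameter (comaximal_graph M) \<le> 2"
  proof (rule graph_diameter_leI)
    fix f g assume "f \<in> pverts (comaximal_graph M)" "g \<in> pverts (comaximal_graph M)"
    then have f: "f \<in> comaximal_vertices M" and g: "g \<in> comaximal_vertices M" by auto
    let ?F = "zero_set M f" and ?G = "zero_set M g"
    have sets: "A \<in> sets M" "B \<in> sets M" "?F \<in> sets M" "?G \<in> sets M"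
      using A B f g zero_set_sets by (auto simp: atom_def)
    \<comment> \<open>Used with \<open>C\<close> and \<open>D\<close> the two atoms, in either
      order: the case where the zero sets belong to different atoms.\<close>
    have int: "emeasure M (?F \<inter> ?G) = 0"
      if C: "C \<in> sets M" "D \<in> sets M" "C \<union> D = space M"
        and null: "emeasure M (C \<inter> ?F) = 0" "emeasure M (D \<inter> ?G) = 0" for C D
    proof -
      have "emeasure M ((C \<inter> ?F) \<union> (D \<inter> ?G)) = 0"
        using C null sets by (intro emeasure_Un_eq_0) auto
      moreover have "?F \<inter> ?G \<subseteq> (C \<inter> ?F) \<union> (D \<inter> ?G)"
        using C by (auto simp: zero_set_def)
      ultimately show ?thesis
        using sets C by (meson emeasure_eq_0 sets.Int sets.Un)
    qed
    \<comment> \<open>The case where both zero sets belong to the same atom, \<open>C\<close> being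
      the other one.\<close>
    have un: "emeasure M (space M - (?F \<union> ?G)) > 0"
      if C: "atom M C" and null: "emeasure M (C \<inter> ?F) = 0" "emeasure M (C \<inter> ?G) = 0" for C
    proof (rule ccontr)
      \<comment> \<open>\<open>C\<close> is covered by its null traces on the two zero sets and by
        the complement of their union; were that complement null too, \<open>C\<close> would be
        null.\<close>
      let ?N = "((C \<inter> ?F) \<union> (C \<inter> ?G)) \<union> (space M - (?F \<union> ?G))"
      have C': "C \<in> sets M" "emeasure M C \<noteq> 0"
        using C by (auto simp: atom_def)
      assume "\<not> emeasure M (space M - (?F \<union> ?G)) > 0"
      then have "emeasure M ?N = 0"
        using C' null sets by (intro emeasure_Un_eq_0) auto
      moreover have "C \<subseteq> ?N"
        using sets.sets_into_space[OF C'(1)] by auto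
      moreover have "?N \<in> sets M" using C' sets by auto
      ultimately show False
        using C' emeasure_eq_0[of ?N M C] by simp
    qed
    show "graph_distance (comaximal_graph M) f g \<le> 2"
      using zero_set_two_atoms[OF A B sp f] zero_set_two_atoms[OF A B sp g]
        int[of A B] int[of B A] un[OF A] un[OF B] sets sp
      by (intro comaximal_graph_distance_le_2[OF f g]) auto
  qed
next
  \<comment> \<open>Two different multiples of the indicator of \<open>A\<close> share the zero set
    \<open>B\<close> of positive measure, so they are not adjacent.\<close>
  let ?h = "\<lambda>c::real. \<lambda>x\<in>space M. c * indicator A x"
  have "space M - A = B" using sp disj by auto
  then have V: "?h c \<in> comaximal_vertices M" and Z: "zero_set M (?h c) = B" if "c \<noteq> 0" for c
    using that A B comaximal_vertices_restrict_indicator[of A M c] zero_set_restrict_indicator[of c M A]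
    by (auto simp: atom_def)
  have "A \<noteq> {}" using A by (auto simp: atom_def)
  then obtain a where "a \<in> A" by auto
  then have "?h 1 a \<noteq> ?h 2 a" using sp by simp
  then have ne: "?h 1 \<noteq> ?h 2" by metis
  have "zero_set M (?h 1) \<inter> zero_set M (?h 2) = B" by (simp only: Z) auto
  then have "(?h 1, ?h 2) \<notin> parcs (comaximal_graph M)"
    using B by (simp only: parcs_comaximal_graph atom_def) auto
  then have "2 \<le> graph_distance (comaximal_graph M) (?h 1) (?h 2)"
    by (rule graph_distance_ge_2[OF ne])
  also have "\<dots> \<le> graph_diameter (comaximal_graph M)"
    using V[of 1] V[of 2] by (intro graph_distance_le_graph_diameter) simp_all
  finally show "2 \<le> graph_diameter (comaximal_graph M)" .
qed

section \<open>Spaces split into three parts of positive measure\<close>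

text \<open>The indicators of \<open>A\<close> and \<open>C\<close> are at distance 3: their zero
  sets overlap in \<open>B\<close>, which excludes adjacency, and together cover the space, which
  excludes a common neighbour.\<close>

lemma comaximal_graph_diameter_three_parts:
  assumes sets: "A \<in> sets M" "B \<in> sets M" "C \<in> sets M"
    and pos: "emeasure M A > 0" "emeasure M B > 0" "emeasure M C > 0"
    and disj: "A \<inter> B = {}" "A \<inter> C = {}" "B \<inter> C = {}"
    and sp: "space M = A \<union> B \<union> C"
  shows "graph_diameter (comaximal_graph M) = 3"
proof (rule antisym)
  show "graph_diameter (comaximal_graph M) \<le> 3"
    by (rule graph_diameter_leI) (simp add: comaximal_graph_distance_le_3)
next
  let ?h = "\<lambda>S. \<lambda>x\<in>space M. 1 * indicator S x :: real"
  have diff: "space M - A = B \<union> C" "space M - C = A \<union> B"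
    using sp disj by auto
  have Z: "zero_set M (?h A) = B \<union> C" "zero_set M (?h C) = A \<union> B"
    using diff by (simp_all only: zero_set_restrict_indicator[OF one_neq_zero])
  have "emeasure M B \<le> emeasure M (B \<union> C)" "emeasure M B \<le> emeasure M (A \<union> B)"
    using sets by (auto intro!: emeasure_mono)
  then have V: "?h A \<in> comaximal_vertices M" "?h C \<in> comaximal_vertices M"
    using sets pos diff by (intro comaximal_vertices_restrict_indicator; auto)+
  have ZZ: "zero_set M (?h A) \<inter> zero_set M (?h C) = B"
    unfolding Z using disj by auto
  have "A \<noteq> {}" using pos by auto
  then have "zero_set M (?h A) \<noteq> zero_set M (?h C)"
    unfolding Z using disj by auto
  then have ne: "?h A \<noteq> ?h C" by metis
  have nonadj: "(?h A, ?h C) \<notin> parcs (comaximal_graph M)"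
    using pos by (simp only: parcs_comaximal_graph ZZ) auto
  \<comment> \<open>A common neighbour \<open>w\<close> would have a zero set that is null inside
    \<open>B \<union> C\<close> and inside \<open>A \<union> B\<close>, hence null
    altogether.\<close>
  have "(w, ?h C) \<notin> parcs (comaximal_graph M)" if "(?h A, w) \<in> parcs (comaximal_graph M)" for w
  proof
    assume "(w, ?h C) \<in> parcs (comaximal_graph M)"
    with that have w: "w \<in> comaximal_vertices M"
      "emeasure M ((B \<union> C) \<inter> zero_set M w) = 0" "emeasure M (zero_set M w \<inter> (A \<union> B)) = 0"
      by (simp_all only: parcs_comaximal_graph Z)
    have "emeasure M (((B \<union> C) \<inter> zero_set M w) \<union> (zero_set M w \<inter> (A \<union> B))) = 0"
      using sets w zero_set_sets[OF w(1)] by (intro emeasure_Un_eq_0) auto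
    moreover have "((B \<union> C) \<inter> zero_set M w) \<union> (zero_set M w \<inter> (A \<union> B)) = zero_set M w"
      using sp by (auto simp: zero_set_def)
    ultimately show False
      using w(1) by (simp add: comaximal_vertices_def)
  qed
  then have "3 \<le> graph_distance (comaximal_graph M) (?h A) (?h C)"
    by (rule graph_distance_ge_3[OF ne nonadj])
  also have "\<dots> \<le> graph_diameter (comaximal_graph M)"
    using V by (intro graph_distance_le_graph_diameter) simp_all
  finally show "3 \<le> graph_diameter (comaximal_graph M)" .
qed

section \<open>Reduction to the two cases\<close>

lemma not_atomE:
  assumes "\<not> atom M A" "A \<in> sets M" "emeasure M A > 0"
  obtains B C where "B \<in> sets M" "C \<in> sets M" "A = B \<union> C" "B \<inter> C = {}"
    "emeasure M B > 0" "emeasure M C > 0"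
  using assms unfolding atom_def by blast

theorem corollary3p14:
  fixes M :: "'a measure"
  assumes "emeasure M (space M) > 0"
    and "\<not> atom M (space M)"
  shows "graph_diameter (comaximal_graph M) =
    (if \<exists>A B. atom M A \<and> atom M B \<and> A \<inter> B = {} \<and> space M = A \<union> B then 2 else 3)"
proof (cases "\<exists>A B. atom M A \<and> atom M B \<and> A \<inter> B = {} \<and> space M = A \<union> B")
  case True
  then show ?thesis using comaximal_graph_diameter_two_atoms by auto
next
  case False
  obtain B C where BC: "B \<in> sets M" "C \<in> sets M" "space M = B \<union> C" "B \<inter> C = {}"
    "emeasure M B > 0" "emeasure M C > 0"
    using not_atomE[OF assms(2) sets.top assms(1)] by blast
  \<comment> \<open>If a piece \<open>D\<close> of a two-piece partition is not an atom, cutting it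
    in two yields three parts together with \<open>E\<close>.\<close>
  have split: "graph_diameter (comaximal_graph M) = 3"
    if D: "\<not> atom M D" "D \<in> sets M" "emeasure M D > 0"
      and E: "E \<in> sets M" "emeasure M E > 0"
      "D \<inter> E = {}" "space M = D \<union> E" for D E
  proof -
    obtain P Q where "P \<in> sets M" "Q \<in> sets M" "D = P \<union> Q" "P \<inter> Q = {}"
      "emeasure M P > 0" "emeasure M Q > 0"
      using not_atomE[OF D] by blast
    then show ?thesis
      using D E by (intro comaximal_graph_diameter_three_parts[of P M Q E]) auto
  qed
  \<comment> \<open>The case assumption applies to every partition, in particular to the one
    obtained from the space not being an atom.\<close>
  have "\<not> atom M B \<or> \<not> atom M C" using False BC by blast
  then have "graph_diameter (comaximal_graph M) = 3"
    using split[of B C] split[of C B] BC by (auto simp: Un_commute Int_commute)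
  then show ?thesis using False by simp
qed

end
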